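(* For every query $Q$, the set of queries returned by the min-res algorithm on input $Q$ (for any order in which triples are selected) is a decomposition $\mathcal{D}_Q$ of $Q$ such that each query in $\mathcal{D}_Q$ is a subject-object star query.
   Context: Fix countably infinite, pairwise disjoint sets $U_{so}$ and $U_p$ (URIs), $L$ (literals) and $\mathrm{Var}$ (variables). A query is a finite non-empty set of triples in $(U_{so}\cup \mathrm{Var})\times U_p\times (U_{so}\cup L\cup \mathrm{Var})$. In a triple $(s,p,o)$, $s$ is the subject and $o$ the object; $\mathcal{N}(Q)$ is the set of all subjects and objects of triples of $Q$. A decomposition of $Q$ is a finite family of non-empty subsets (subqueries) of $Q$ whose union is $Q$. A subject-object star query (so-query) is a query for which there is a node $c$ (central node) such that every triple has $c$ as subject or object and at least one triple has $c$ as subject. The min-res algorithm on input $Q$. Partition $Q$ into: $T_{so}$ (triples whose subject and object are both variables), $T_{sub}$ (only the subject is a variable), $T_{obj}$ (only the object is a variable), $T_c$ (neither is a variable). Set $R=\emptyset$. Step 1. For each $t=(s,p,o)\in T_{so}$: let $Q_s=\{t\}\cup\{t'\in T_{sub}: t' \text{ has subject } s\}\cup\{t''\in T_{obj}: t''\text{ has object } s\}$; let $S=\{t'\in T_{sub}: t'\text{ has subject }o\}$; if $S=\emptyset$ let $Q_o=\emptyset$, else let $Q_o=\{t\}\cup S\cup\{t''\in T_{obj}: t''\text{ has object }o\}$. If $|Q_s|\ge|Q_o|$ put $Q'=Q_s$, else $Q'=Q_o$; add $Q'$ to $R$. (During this step $T_{sub},T_{obj}$ are not modified.) Afterwards remove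 from $T_{sub}$ and $T_{obj}$ all triples belonging to some member of $R$. Step 2. While $T_{sub}\ne\emptyset$: extract (take and remove) a triple $t=(s,p,o)$ from $T_{sub}$; let $Q'=\{t\}\cup\{t'\in T_{sub}: t'\text{ has subject }s\}\cup\{t''\in T_{obj}: t''\text{ has object }s\}$. If $|Q'|=1$, let $S=\{t'\in T_c: t'\text{ has subject }o\}$ and, if $S\neq\emptyset$, redefine $Q'=\{t\}\cup S\cup\{t''\in T_c: t''\text{ has object }o\}$. Remove the triples of $Q'$ from $T_{sub}$ and from $T_{obj}$; add $Q'$ to $R$. Step 3. For each $t=(s,p,o)\in T_{obj}$: add to $R$ the query $Q'=\{t\}\cup\{t'\in T_c: t'\text{ has subject }s\}\cup\{t''\in T_c: t''\text{ has object }s\}$. Afterwards remove from $T_c$ all triples belonging to some member of $R$. Step 4. While $T_c\neq\emptyset$: extract a triple $t=(s,p,o)$ from $T_c$; let $Q_s=\{t\}\cup\{t'\in T_c: t'\text{ has subject }s\}\cup\{t''\in T_c: t''\text{ has object }s\}$; let $S=\{t'\in T_c: t'\text{ has subject }o\}$; if $S=\emptyset$ let $Q_o=\emptyset$, else $Q_o=\{t\}\cup S\cup\{t''\in T_c: t''\text{ has object }o\}$. If $|Q_s|\ge|Q_o|$ put $Q'=Q_s$, else $Q'=Q_o$. Add $Q'$ to $R$ and remove the triples of $Q'$ from $T_c$. Return $R$. *)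

theory Defs
  imports "HOL-Library.Countable_Set"
begin

definition rdf_vocabulary :: "'a set \<Rightarrow> 'a set \<Rightarrow> 'a set \<Rightarrow> 'a set \<Rightarrow> bool" where
  "rdf_vocabulary U_so U_p L Var \<longleftrightarrow>
     countable U_so \<and> infinite U_so \<and> countable U_p \<and> infinite U_p \<and>
     countable L \<and> infinite L \<and> countable Var \<and> infinite Var \<and>
     disjnt U_so U_p \<and> disjnt U_so L \<and> disjnt U_so Var \<and>
     disjnt U_p L \<and> disjnt U_p Var \<and> disjnt L Var"

type_synonym 'a triple = "'a \<times> 'a \<times> 'a"

definition subject :: "'a triple \<Rightarrow> 'a" where
  "subject t = fst t"

definition object :: "'a triple \<Rightarrow> 'a" where
  "object t = snd (snd t)"

definition is_query :: "'a set \<Rightarrow> 'a set \<Rightarrow> 'a set \<Rightarrow> 'a set \<Rightarrow> 'a triple set \<Rightarrow> bool" where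
  "is_query U_so U_p L Var Q \<longleftrightarrow>
     finite Q \<and> Q \<noteq> {} \<and> Q \<subseteq> (U_so \<union> Var) \<times> U_p \<times> (U_so \<union> L \<union> Var)"

definition nodes :: "'a triple set \<Rightarrow> 'a set" where
  "nodes Q = subject ` Q \<union> object ` Q"

definition is_decomposition :: "'a triple set \<Rightarrow> 'a triple set set \<Rightarrow> bool" where
  "is_decomposition Q D \<longleftrightarrow> finite D \<and> (\<forall>Q'\<in>D. Q' \<noteq> {} \<and> Q' \<subseteq> Q) \<and> \<Union>D = Q"

definition so_query :: "'a set \<Rightarrow> 'a set \<Rightarrow> 'a set \<Rightarrow> 'a set \<Rightarrow> 'a triple set \<Rightarrow> bool" where
  "so_query U_so U_p L Var Q \<longleftrightarrow>
     is_query U_so U_p L Var Q \<and>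
     (\<exists>c\<in>nodes Q. (\<forall>t\<in>Q. subject t = c \<or> object t = c) \<and> (\<exists>t\<in>Q. subject t = c))"

definition T_so :: "'a set \<Rightarrow> 'a triple set \<Rightarrow> 'a triple set" where
  "T_so Var Q = {t \<in> Q. subject t \<in> Var \<and> object t \<in> Var}"

definition T_sub :: "'a set \<Rightarrow> 'a triple set \<Rightarrow> 'a triple set" where
  "T_sub Var Q = {t \<in> Q. subject t \<in> Var \<and> object t \<notin> Var}"

definition T_obj :: "'a set \<Rightarrow> 'a triple set \<Rightarrow> 'a triple set" where
  "T_obj Var Q = {t \<in> Q. subject t \<notin> Var \<and> object t \<in> Var}"

definition T_c :: "'a set \<Rightarrow> 'a triple set \<Rightarrow> 'a triple set" where
  "T_c Var Q = {t \<in> Q. subject t \<notin> Var \<and> object t \<notin> Var}"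

definition with_subject :: "'a triple set \<Rightarrow> 'a \<Rightarrow> 'a triple set" where
  "with_subject T c = {t \<in> T. subject t = c}"

definition with_object :: "'a triple set \<Rightarrow> 'a \<Rightarrow> 'a triple set" where
  "with_object T c = {t \<in> T. object t = c}"

definition star_at :: "'a triple set \<Rightarrow> 'a triple set \<Rightarrow> 'a triple \<Rightarrow> 'a \<Rightarrow> 'a triple set" where
  "star_at A B t c = {t} \<union> with_subject A c \<union> with_object B c"

text \<open>The choice between \<open>Q_s\<close> and \<open>Q_o\<close>, made in step 1 with \<open>A = T_sub\<close>, \<open>B = T_obj\<close>
  and in step 4 with \<open>A = B = T_c\<close>.\<close>

definition larger_star :: "'a triple set \<Rightarrow> 'a triple set \<Rightarrow> 'a triple \<Rightarrow> 'a triple set" where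
  "larger_star A B t =
     (let Q_s = star_at A B t (subject t);
          S = with_subject A (object t);
          Q_o = (if S = {} then {} else star_at A B t (object t))
      in if card Q_s \<ge> card Q_o then Q_s else Q_o)"

definition step2_query ::
    "'a triple set \<Rightarrow> 'a triple set \<Rightarrow> 'a triple set \<Rightarrow> 'a triple \<Rightarrow> 'a triple set" where
  "step2_query C A B t =
     (let Q' = star_at A B t (subject t);
          S = with_subject C (object t)
      in if card Q' = 1 \<and> S \<noteq> {} then star_at C C t (object t) else Q')"

text \<open>One iteration of each of the two while loops, with the extracted triple \<open>t\<close> chosen
  nondeterministically. Loop states are \<open>(T_sub, T_obj, R)\<close> and \<open>(T_c, R)\<close>; the parameter
  \<open>C\<close> of the first loop is \<open>T_c\<close>, which that loop does not modify. The query is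
  built after \<open>t\<close> has been taken out.\<close>

inductive step2 ::
    "'a triple set \<Rightarrow> 'a triple set \<times> 'a triple set \<times> 'a triple set set \<Rightarrow>
     'a triple set \<times> 'a triple set \<times> 'a triple set set \<Rightarrow> bool"
  for C where
  "t \<in> A \<Longrightarrow> Q' = step2_query C (A - {t}) B t \<Longrightarrow>
   step2 C (A, B, R) (A - {t} - Q', B - Q', insert Q' R)"

inductive step4 ::
    "'a triple set \<times> 'a triple set set \<Rightarrow> 'a triple set \<times> 'a triple set set \<Rightarrow> bool" where
  "t \<in> C \<Longrightarrow> Q' = larger_star (C - {t}) (C - {t}) t \<Longrightarrow>
   step4 (C, R) (C - {t} - Q', insert Q' R)"

text \<open>\<open>min_res_returns Var Q R\<close>: some run of the algorithm on input \<open>Q\<close> ends with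
  result \<open>R\<close>. The for-each loops of steps 1 and 3 do not modify the sets they read, so
  their order is immaterial and each is the image of a set.\<close>

definition min_res_returns :: "'a set \<Rightarrow> 'a triple set \<Rightarrow> 'a triple set set \<Rightarrow> bool" where
  "min_res_returns Var Q R \<longleftrightarrow>
     (\<exists>R1 B2 R2 R3.
        R1 = larger_star (T_sub Var Q) (T_obj Var Q) ` T_so Var Q \<and>
        (step2 (T_c Var Q))\<^sup>*\<^sup>* (T_sub Var Q - \<Union>R1, T_obj Var Q - \<Union>R1, R1) ({}, B2, R2) \<and>
        R3 = R2 \<union> (\<lambda>t. star_at (T_c Var Q) (T_c Var Q) t (subject t)) ` B2 \<and>
        step4\<^sup>*\<^sup>* (T_c Var Q - \<Union>R3, R3) ({}, R))"

end

theory Submission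
  imports Defs
begin

text \<open>Every query built by the algorithm consists of triples of \<open>Q\<close> incident to one node that is
  the subject of one of them, and each iteration of a loop puts all triples it removes into the
  result. Hence stardom of the members of the result, and coverage of \<open>Q\<close> by the result together
  with the unprocessed triples, are loop invariants. The while loops end since each iteration
  shrinks a finite set.\<close>

definition star_in :: "'a triple set \<Rightarrow> 'a triple set \<Rightarrow> bool" where
  "star_in Q Q' \<longleftrightarrow>
     Q' \<subseteq> Q \<and> (\<exists>c\<in>subject ` Q'. \<forall>t\<in>Q'. subject t = c \<or> object t = c)"

lemma star_inI:
  assumes "Q' \<subseteq> Q" "u \<in> Q'"
    "\<And>t. t \<in> Q' \<Longrightarrow> subject t = subject u \<or> object t = subject u"
  shows "star_in Q Q'"
  using assms unfolding star_in_def by blast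

lemma so_query_if_star_in:
  assumes "is_query U_so U_p L Var Q" "star_in Q Q'"
  shows "so_query U_so U_p L Var Q'"
  using assms
  unfolding so_query_def is_query_def star_in_def nodes_def
  by (auto intro: finite_subset)

lemma star_at_subset: "t \<in> Q \<Longrightarrow> A \<subseteq> Q \<Longrightarrow> B \<subseteq> Q \<Longrightarrow> star_at A B t c \<subseteq> Q"
  by (auto simp: star_at_def with_subject_def with_object_def)

lemma star_in_star_at_subject:
  assumes "t \<in> Q" "A \<subseteq> Q" "B \<subseteq> Q"
  shows "star_in Q (star_at A B t (subject t))"
  using star_at_subset[OF assms]
proof (rule star_inI)
  show "t \<in> star_at A B t (subject t)" by (simp add: star_at_def)
qed (auto simp: star_at_def with_subject_def with_object_def)

text \<open>Here \<open>t\<close> itself has the centre only as an object in general, so the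
  required subject occurrence comes from a member of \<open>with_subject A (object t)\<close>. This
  is the purpose of the test \<open>S = {}\<close> in the algorithm.\<close>

lemma star_in_star_at_object:
  assumes "t \<in> Q" "A \<subseteq> Q" "B \<subseteq> Q" "with_subject A (object t) \<noteq> {}"
  shows "star_in Q (star_at A B t (object t))"
proof -
  obtain u where u: "u \<in> with_subject A (object t)" using assms(4) by blast
  then have "subject u = object t" by (simp add: with_subject_def)
  with star_at_subset[OF assms(1-3)] show ?thesis
  proof (intro star_inI)
    show "u \<in> star_at A B t (object t)" using u by (simp add: star_at_def)
  qed (auto simp: star_at_def with_subject_def with_object_def)
qed

text \<open>An empty \<open>Q_o\<close> has cardinality 0, so the comparison then selects
  \<open>Q_s\<close>; otherwise both candidates are stars containing \<open>t\<close>.\<close>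

lemma star_in_larger_star:
  assumes "finite Q" "t \<in> Q" "A \<subseteq> Q" "B \<subseteq> Q"
  shows "star_in Q (larger_star A B t)" "t \<in> larger_star A B t"
proof -
  have "finite (star_at A B t (subject t))"
    using star_at_subset[OF assms(2-4)] assms(1) finite_subset by blast
  then have "0 < card (star_at A B t (subject t))"
    by (auto simp: card_gt_0_iff star_at_def)
  then show "star_in Q (larger_star A B t)" "t \<in> larger_star A B t"
    using star_in_star_at_subject[OF assms(2-4)] star_in_star_at_object[OF assms(2-4)]
    by (auto simp: larger_star_def Let_def star_at_def)
qed

text \<open>The fallback draws on \<open>C\<close> for both directions, and its guard supplies the
  triple of \<open>C\<close> whose subject is \<open>object t\<close>.\<close>

lemma star_in_step2_query:
  assumes "t \<in> Q" "A \<subseteq> Q" "B \<subseteq> Q" "C \<subseteq> Q"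
  shows "star_in Q (step2_query C A B t)" "t \<in> step2_query C A B t"
  using star_in_star_at_subject[OF assms(1-3)] star_in_star_at_object[OF assms(1,4,4)]
  by (auto simp: step2_query_def Let_def star_at_def)

text \<open>\<open>P\<close> holds the pending triples and \<open>X\<close> those to be accounted
  for. \<open>X\<close> is separate from \<open>Q\<close> because the triples of \<open>T_c\<close>
  enter the count only when step 4 begins.\<close>

definition partial_decomposition ::
    "'a triple set \<Rightarrow> 'a triple set \<Rightarrow> 'a triple set \<Rightarrow> 'a triple set set \<Rightarrow> bool" where
  "partial_decomposition Q X P R \<longleftrightarrow>
     P \<subseteq> Q \<and> finite R \<and> (\<forall>Q'\<in>R. star_in Q Q') \<and> X \<subseteq> P \<union> \<Union>R"

text \<open>Coverage survives because \<open>t\<close>, although extracted before \<open>Q'\<close>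
  is built, belongs to \<open>Q'\<close>; every other removed triple lies in \<open>Q'\<close> by
  construction.\<close>

lemma partial_decomposition_step2:
  assumes "step2 C (A, B, R) (A', B', R')"
    and "C \<subseteq> Q" "partial_decomposition Q X (A \<union> B) R"
  shows "partial_decomposition Q X (A' \<union> B') R'"
  using assms(1)
proof cases
  case (1 t Q')
  have "star_in Q Q'" "t \<in> Q'"
    using assms(2,3) 1 star_in_step2_query[of t Q "A - {t}" B C]
    by (auto simp: partial_decomposition_def)
  then show ?thesis
    using assms(3) 1 by (auto simp: partial_decomposition_def)
qed

lemma partial_decomposition_step4:
  assumes "step4 (C, R) (C', R')" and "finite Q" "partial_decomposition Q X C R"
  shows "partial_decomposition Q X C' R'"
  using assms(1)
proof cases
  case (1 t Q')
  have "star_in Q Q'" "t \<in> Q'"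
    using assms(2,3) 1 star_in_larger_star[of Q t "C - {t}" "C - {t}"]
    by (auto simp: partial_decomposition_def)
  then show ?thesis
    using assms(3) 1 by (auto simp: partial_decomposition_def)
qed

lemma partial_decomposition_step2_rtranclp:
  assumes "(step2 C)\<^sup>*\<^sup>* (A, B, R) (A', B', R')"
    and "C \<subseteq> Q" "partial_decomposition Q X (A \<union> B) R"
  shows "partial_decomposition Q X (A' \<union> B') R'"
  using assms(1)
proof (induction "(A', B', R')" arbitrary: A' B' R' rule: rtranclp_induct)
  case base
  then show ?case using assms(3) by simp
next
  case (step s)
  obtain A0 B0 R0 where s: "s = (A0, B0, R0)" by (cases s)
  show ?case
    by (rule partial_decomposition_step2[OF step.hyps(2)[unfolded s] assms(2) step.hyps(3)[OF s]])
qed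

lemma partial_decomposition_step4_rtranclp:
  assumes "step4\<^sup>*\<^sup>* (C, R) (C', R')" and "finite Q" "partial_decomposition Q X C R"
  shows "partial_decomposition Q X C' R'"
  using assms(1)
proof (induction "(C', R')" arbitrary: C' R' rule: rtranclp_induct)
  case base
  then show ?case using assms(3) by simp
next
  case (step s)
  obtain C0 R0 where s: "s = (C0, R0)" by (cases s)
  show ?case
    by (rule partial_decomposition_step4[OF step.hyps(2)[unfolded s] assms(2) step.hyps(3)[OF s]])
qed

text \<open>\<open>A\<close> loses at least the extracted triple in each iteration. \<open>B\<close>
  and \<open>R\<close> are generalized because they change along the run.\<close>

lemma step2_terminates: "finite A \<Longrightarrow> \<exists>B' R'. (step2 C)\<^sup>*\<^sup>* (A, B, R) ({}, B', R')"
proof (induction A arbitrary: B R rule: finite_psubset_induct)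
  case (psubset A)
  show ?case
  proof (cases "A = {}")
    case False
    then obtain t where t: "t \<in> A" by blast
    define Q' where "Q' = step2_query C (A - {t}) B t"
    have "step2 C (A, B, R) (A - {t} - Q', B - Q', insert Q' R)"
      using t Q'_def by (rule step2.intros)
    moreover have "A - {t} - Q' \<subset> A" using t by blast
    ultimately show ?thesis
      using psubset.IH by (meson converse_rtranclp_into_rtranclp)
  qed auto
qed

lemma step4_terminates: "finite C \<Longrightarrow> \<exists>R'. step4\<^sup>*\<^sup>* (C, R) ({}, R')"
proof (induction C arbitrary: R rule: finite_psubset_induct)
  case (psubset C)
  show ?case
  proof (cases "C = {}")
    case False
    then obtain t where t: "t \<in> C" by blast
    define Q' where "Q' = larger_star (C - {t}) (C - {t}) t"
    have "step4 (C, R) (C - {t} - Q', insert Q' R)"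
      using t Q'_def by (rule step4.intros)
    moreover have "C - {t} - Q' \<subset> C" using t by blast
    ultimately show ?thesis
      using psubset.IH by (meson converse_rtranclp_into_rtranclp)
  qed auto
qed

text \<open>This keeps the claim about all results from being vacuous.\<close>

lemma min_res_returns_exists:
  assumes "finite Q"
  shows "\<exists>D. min_res_returns Var Q D"
proof -
  have "finite (T_sub Var Q)" "finite (T_c Var Q)"
    using assms by (auto simp: T_sub_def T_c_def)
  then show ?thesis
    unfolding min_res_returns_def using step2_terminates step4_terminates by (meson finite_Diff)
qed

lemma partial_decomposition_min_res:
  assumes "finite Q" "min_res_returns Var Q D"
  shows "partial_decomposition Q Q {} D"
proof -
  obtain R1 B2 R2 R3 where
    R1: "R1 = larger_star (T_sub Var Q) (T_obj Var Q) ` T_so Var Q" and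
    steps2: "(step2 (T_c Var Q))\<^sup>*\<^sup>*
      (T_sub Var Q - \<Union>R1, T_obj Var Q - \<Union>R1, R1) ({}, B2, R2)" and
    R3: "R3 = R2 \<union> (\<lambda>t. star_at (T_c Var Q) (T_c Var Q) t (subject t)) ` B2" and
    steps4: "step4\<^sup>*\<^sup>* (T_c Var Q - \<Union>R3, R3) ({}, D)"
    using assms(2) unfolding min_res_returns_def by blast
  have sub: "T_sub Var Q \<subseteq> Q" "T_obj Var Q \<subseteq> Q" "T_so Var Q \<subseteq> Q" "T_c Var Q \<subseteq> Q"
    and split: "Q = T_so Var Q \<union> T_sub Var Q \<union> T_obj Var Q \<union> T_c Var Q"
    by (auto simp: T_sub_def T_obj_def T_so_def T_c_def)
  let ?X = "T_so Var Q \<union> T_sub Var Q \<union> T_obj Var Q"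
  have "star_in Q (larger_star (T_sub Var Q) (T_obj Var Q) t)"
    "t \<in> larger_star (T_sub Var Q) (T_obj Var Q) t" if "t \<in> T_so Var Q" for t
    using star_in_larger_star[OF assms(1) subsetD[OF sub(3) that] sub(1,2)] by simp_all
  moreover have "finite R1"
    using R1 assms(1) sub(3) finite_subset by blast
  \<comment> \<open>Each triple of \<open>T_so\<close> is covered by its own star; those of
    \<open>T_sub\<close> and \<open>T_obj\<close> are either covered or still pending.\<close>
  ultimately have "partial_decomposition Q ?X
      ((T_sub Var Q - \<Union>R1) \<union> (T_obj Var Q - \<Union>R1)) R1"
    using sub unfolding partial_decomposition_def R1 by auto
  then have 2: "partial_decomposition Q ?X B2 R2"
    using partial_decomposition_step2_rtranclp[OF steps2 sub(4)] by simp
  then have B2: "B2 \<subseteq> Q" "finite B2"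
    using assms(1) finite_subset by (auto simp: partial_decomposition_def)
  have "star_in Q (star_at (T_c Var Q) (T_c Var Q) t (subject t))" if "t \<in> B2" for t
    using star_in_star_at_subject[OF _ sub(4,4)] that B2(1) by blast
  moreover have "t \<in> star_at (T_c Var Q) (T_c Var Q) t (subject t)" for t
    by (simp add: star_at_def)
  \<comment> \<open>Step 3 builds a star around every triple left in \<open>B2\<close>, so nothing
    of \<open>?X\<close> stays pending.\<close>
  ultimately have "partial_decomposition Q ?X {} R3"
    using 2 B2 unfolding partial_decomposition_def R3 by fastforce
  \<comment> \<open>The target grows from \<open>?X\<close> to \<open>Q\<close>: a triple of
    \<open>T_c\<close> is either in a member of \<open>R3\<close> or pending for step 4.\<close>
  then have "partial_decomposition Q Q (T_c Var Q - \<Union>R3) R3"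
    using sub(4) split unfolding partial_decomposition_def by blast
  then show ?thesis
    using partial_decomposition_step4_rtranclp[OF steps4 assms(1)] by blast
qed

theorem proposition11:
  fixes U_so U_p L Var :: "'a set" and Q :: "'a triple set"
  assumes "rdf_vocabulary U_so U_p L Var"
    and "is_query U_so U_p L Var Q"
  shows "(\<exists>D. min_res_returns Var Q D) \<and>
    (\<forall>D. min_res_returns Var Q D \<longrightarrow>
       is_decomposition Q D \<and> (\<forall>Q'\<in>D. so_query U_so U_p L Var Q'))"
proof (intro conjI allI impI)
  have fin: "finite Q" using assms(2) by (simp add: is_query_def)
  then show "\<exists>D. min_res_returns Var Q D" by (rule min_res_returns_exists)
  fix D
  assume "min_res_returns Var Q D"
  with fin have D: "partial_decomposition Q Q {} D" by (rule partial_decomposition_min_res)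
  then show "is_decomposition Q D"
    unfolding partial_decomposition_def is_decomposition_def star_in_def by blast
  from D show "\<forall>Q'\<in>D. so_query U_so U_p L Var Q'"
    using so_query_if_star_in[OF assms(2)] by (auto simp: partial_decomposition_def)
qed

end
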